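(* Let $L\ge 4$ be even and let $G=(V,E)$ be the $L\times L$ toroidal grid graph. Let $D\subseteq V$ have even cardinality. Then $G$ has a minimum-size $D$-join $J$ such that every vertex of $D$ has $J$-degree exactly $1$. More specifically, if $J$ is any minimum-size $D$-join of $G$, then there is a set $P$ of plaquettes such that $J' = J \oplus \bigoplus_{f\in P}\partial f$ satisfies $|J'|=|J|$ and every vertex of $D$ has $J'$-degree exactly $1$.
   Context: The $L\times L$ toroidal grid graph $G=(V,E)$ has vertex set $V=\mathbb{Z}_L\times\mathbb{Z}_L$. Its edges are $\{(i,j),(i+1,j)\}$ and $\{(i,j),(i,j+1)\}$ for all $(i,j)$, with indices taken mod $L$. For each $(i,j)\in\mathbb{Z}_L^2$, the plaquette $f_{i,j}$ has boundary $\partial f_{i,j}=\{\{(i,j),(i+1,j)\},\{(i+1,j),(i+1,j+1)\},\{(i,j+1),(i+1,j+1)\},\{(i,j),(i,j+1)\}\}$. The symbol $\oplus$ denotes symmetric difference of edge sets. For a set $J\subseteq E$, the $J$-degree of a vertex $v$ is the number of edges of $J$ incident to $v$. For $D\subseteq V$ of even size, a $D$-join is a set $J\subseteq E$ such that every vertex of $D$ has odd $J$-degree and every vertex of $V\setminus D$ has even $J$-degree. (This graph is the primal lattice of the $[[2L^2,2,L]]$ toric code; the dual lattice is isomorphic to it.) *)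

theory Defs
  imports Main
begin

type_synonym vert = "nat \<times> nat"
type_synonym edge = "vert set"

definition V :: "nat \<Rightarrow> vert set" where
  "V L = {0..<L} \<times> {0..<L}"

definition hedge :: "nat \<Rightarrow> vert \<Rightarrow> edge" where
  "hedge L v = {v, ((fst v + 1) mod L, snd v)}"

definition vedge :: "nat \<Rightarrow> vert \<Rightarrow> edge" where
  "vedge L v = {v, (fst v, (snd v + 1) mod L)}"

definition E :: "nat \<Rightarrow> edge set" where
  "E L = hedge L ` V L \<union> vedge L ` V L"

definition pbound :: "nat \<Rightarrow> vert \<Rightarrow> edge set" where
  "pbound L v = (let i = fst v; j = snd v; i' = (i + 1) mod L; j' = (j + 1) mod L in
     {{(i,j),(i',j)}, {(i',j),(i',j')}, {(i,j'),(i',j')}, {(i,j),(i,j')}})"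

text \<open>Symmetric difference of the boundaries of all plaquettes in P (edges in an odd number of them).\<close>
definition psum :: "nat \<Rightarrow> vert set \<Rightarrow> edge set" where
  "psum L P = {e. odd (card {f \<in> P. e \<in> pbound L f})}"

definition symdiff :: "'a set \<Rightarrow> 'a set \<Rightarrow> 'a set" where
  "symdiff A B = (A - B) \<union> (B - A)"

definition jdeg :: "edge set \<Rightarrow> vert \<Rightarrow> nat" where
  "jdeg J v = card {e \<in> J. v \<in> e}"

definition is_join :: "nat \<Rightarrow> vert set \<Rightarrow> edge set \<Rightarrow> bool" where
  "is_join L D J \<longleftrightarrow> J \<subseteq> E L \<and> (\<forall>v \<in> V L. (odd (jdeg J v) \<longleftrightarrow> v \<in> D))"

definition is_min_join :: "nat \<Rightarrow> vert set \<Rightarrow> edge set \<Rightarrow> bool" where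
  "is_min_join L D J \<longleftrightarrow> is_join L D J \<and> (\<forall>J'. is_join L D J' \<longrightarrow> card J \<le> card J')"

end

theory Submission
  imports Defs
begin

text \<open>Call a vertex of \<open>D\<close> of degree 3 in a minimum join \<open>J\<close> a defect. Each of the two plaquettes in
  the corners of this T has exactly two edges in \<open>J\<close>, so flipping one keeps \<open>J\<close> minimum. It repairs
  the defect but adds 2 to the degree of the diagonally opposite vertex \<open>c\<close>. Among the minimum joins
  reachable by flips choose one with fewest defects; then \<open>c\<close> must lie in \<open>D\<close> with degree 1 and becomes
  a defect itself, so the defect can be pushed on forever. It stays in one colour class of the
  bipartite torus (\<open>L\<close> is even), and at every vertex there the horizontal or vertical axis of its
  edge never changes. Following these axes, the walk turns by a right angle at each step, never
  retraces itself, and passes a vertex alternately in the two directions on the two sides. The set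
  of vertices visited infinitely often is therefore closed under all four diagonal moves, so it is
  the whole colour class \<open>C\<close>, and \<open>C \<subseteq> D\<close>. But if \<open>C \<subseteq> D\<close> there is a \<open>D\<close>-join with exactly one edge at
  each vertex of \<open>C\<close>. It has \<open>|C|\<close> edges, whereas \<open>J\<close>, with a vertex of degree 3 in \<open>C\<close>, has more.\<close>

section \<open>Symmetric differences, parity and boundaries\<close>

lemma finite_symdiff [simp]: "finite A \<Longrightarrow> finite B \<Longrightarrow> finite (symdiff A B)"
  by (simp add: symdiff_def)

lemma mem_symdiff [simp]: "x \<in> symdiff A B \<longleftrightarrow> (x \<in> A) \<noteq> (x \<in> B)"
  by (auto simp: symdiff_def)

lemma card_symdiff:
  assumes "finite A" "finite B"
  shows "card (symdiff A B) + 2 * card (A \<inter> B) = card A + card B"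
proof -
  have "card (symdiff A B) = card (A - B) + card (B - A)"
    unfolding symdiff_def by (rule card_Un_disjoint) (use assms in auto)
  moreover have "card A = card (A - B) + card (A \<inter> B)"
    by (metis assms(1) card_Diff_subset_Int card_mono finite_Int inf_le1 le_add_diff_inverse2)
  moreover have "card B = card (B - A) + card (A \<inter> B)"
    by (metis assms card_Diff_subset_Int card_mono finite_Int inf_le1 inf_commute le_add_diff_inverse2)
  ultimately show ?thesis by simp
qed

lemma odd_card_symdiff:
  assumes "finite A" "finite B"
  shows "odd (card (symdiff A B)) \<longleftrightarrow> odd (card A) \<noteq> odd (card B)"
  using card_symdiff[OF assms] by presburger

lemma odd_card_filter_symdiff:
  assumes "finite A" "finite B"
  shows "odd (card {x \<in> symdiff A B. Q x}) \<longleftrightarrow>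
    odd (card {x \<in> A. Q x}) \<noteq> odd (card {x \<in> B. Q x})"
proof -
  have "{x \<in> symdiff A B. Q x} = symdiff {x \<in> A. Q x} {x \<in> B. Q x}"
    by auto
  then show ?thesis using assms by (simp add: odd_card_symdiff)
qed

text \<open>View each \<open>x\<close> in \<open>I\<close> as an edge with ends \<open>p x\<close>
  and \<open>q x\<close>. If these edges connect \<open>U\<close>, the points of \<open>S\<close>
  can be paired off, and the paths joining the pairs, added modulo 2, have boundary
  \<open>S\<close>. Working with an index set instead of pairs allows parallel edges.\<close>

lemma even_set_is_boundary:
  fixes p q :: "'a \<Rightarrow> 'b"
  assumes fin: "finite I"
    and ne: "\<And>x. x \<in> I \<Longrightarrow> p x \<noteq> q x"
    and conn: "\<And>u w. u \<in> U \<Longrightarrow> w \<in> U \<Longrightarrow>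
      (u, w) \<in> ((\<lambda>x. (p x, q x)) ` I \<union> (\<lambda>x. (q x, p x)) ` I)\<^sup>*"
    and S: "finite S" "S \<subseteq> U" "even (card S)"
  shows "\<exists>X\<subseteq>I. \<forall>w. odd (card {x \<in> X. p x = w \<or> q x = w}) \<longleftrightarrow> w \<in> S"
proof -
  let ?R = "(\<lambda>x. (p x, q x)) ` I \<union> (\<lambda>x. (q x, p x)) ` I"
  let ?b = "\<lambda>X w. odd (card {x \<in> X. p x = w \<or> q x = w})"
  have add: "?b (symdiff X Y) w \<longleftrightarrow> ?b X w \<noteq> ?b Y w" if "X \<subseteq> I" "Y \<subseteq> I" for X Y w
    using that fin by (intro odd_card_filter_symdiff) (auto intro: finite_subset)
  have sub: "symdiff X Y \<subseteq> I" if "X \<subseteq> I" "Y \<subseteq> I" for X Y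
    using that by (auto simp: symdiff_def)
  have path: "\<exists>X\<subseteq>I. \<forall>v. ?b X v \<longleftrightarrow> (v = u) \<noteq> (v = w)" if "(u, w) \<in> ?R\<^sup>*" for u w
    using that
  proof (induction rule: rtrancl_induct)
    case base
    show ?case by (intro exI[of _ "{}"]) auto
  next
    case (step y z)
    then obtain X where X: "X \<subseteq> I" "\<forall>v. ?b X v \<longleftrightarrow> (v = u) \<noteq> (v = y)" by blast
    from step obtain x where x: "x \<in> I" "{p x, q x} = {y, z}" by auto
    have "?b {x} v \<longleftrightarrow> (v = y) \<noteq> (v = z)" for v
    proof -
      have "{x' \<in> {x}. p x' = v \<or> q x' = v} = (if v \<in> {p x, q x} then {x} else {})"
        by auto
      moreover have "y \<noteq> z" using ne x by (metis doubleton_eq_iff)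
      ultimately show ?thesis unfolding x(2) by auto
    qed
    then have "\<forall>v. ?b (symdiff X {x}) v \<longleftrightarrow> (v = u) \<noteq> (v = z)"
      using add[of X "{x}"] X x by auto
    then show ?case using sub[of X "{x}"] X x by blast
  qed
  show ?thesis
    using S
  proof (induction "card S" arbitrary: S rule: less_induct)
    case less
    show ?case
    proof (cases "S = {}")
      case True
      then show ?thesis by (intro exI[of _ "{}"]) auto
    next
      case False
      then obtain u where u: "u \<in> S" by blast
      with less have "S \<noteq> {u}" by auto
      with u obtain w where w: "w \<in> S" "w \<noteq> u" by blast
      let ?S = "S - {u, w}"
      have cS: "card S = card ?S + 2"
        using card_Diff_subset[of "{u,w}" S] card_mono[of S "{u,w}"] less.prems u w by auto
      moreover have "even (card ?S)" using cS less.prems by simp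
      ultimately obtain X where X: "X \<subseteq> I" "\<forall>v. ?b X v \<longleftrightarrow> v \<in> ?S"
        using less.hyps[of ?S] less.prems by auto
      obtain Y where Y: "Y \<subseteq> I" "\<forall>v. ?b Y v \<longleftrightarrow> (v = u) \<noteq> (v = w)"
        using path[OF conn[of u w]] u w less.prems by blast
      have "\<forall>v. ?b (symdiff X Y) v \<longleftrightarrow> v \<in> S"
        using add[OF X(1) Y(1)] X Y u w by auto
      then show ?thesis using sub[OF X(1) Y(1)] by blast
    qed
  qed
qed

lemma psum_toggle:
  assumes "finite P"
  shows "psum L (symdiff P {f}) = symdiff (psum L P) (pbound L f)"
proof (rule set_eqI)
  fix e
  have "{g \<in> {f}. e \<in> pbound L g} = (if e \<in> pbound L f then {f} else {})" by auto
  then have "odd (card {g \<in> {f}. e \<in> pbound L g}) \<longleftrightarrow> e \<in> pbound L f" by simp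
  then show "e \<in> psum L (symdiff P {f}) \<longleftrightarrow> e \<in> symdiff (psum L P) (pbound L f)"
    using odd_card_filter_symdiff[OF assms, of "{f}" "\<lambda>g. e \<in> pbound L g"]
    by (simp add: psum_def)
qed

section \<open>The torus: signed directions, colours and edges\<close>

locale torus =
  fixes L :: nat
  assumes L4: "4 \<le> L" and evL: "even L"
begin

text \<open>Adding \<open>L\<close> before subtracting avoids truncation at 0. The Boolean is the
  sign of the step, so that one argument can serve all four quadrants around a vertex.\<close>

definition shift :: "bool \<Rightarrow> nat \<Rightarrow> nat" where
  "shift s i = (if s then (i + 1) mod L else (i + L - 1) mod L)"

definition hor :: "bool \<Rightarrow> vert \<Rightarrow> vert" where
  "hor s x = (shift s (fst x), snd x)"

definition ver :: "bool \<Rightarrow> vert \<Rightarrow> vert" where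
  "ver t x = (fst x, shift t (snd x))"

definition hor_edge :: "bool \<Rightarrow> vert \<Rightarrow> edge" where
  "hor_edge s x = {x, hor s x}"

definition ver_edge :: "bool \<Rightarrow> vert \<Rightarrow> edge" where
  "ver_edge t x = {x, ver t x}"

abbreviation diag :: "bool \<Rightarrow> bool \<Rightarrow> vert \<Rightarrow> vert" where
  "diag s t x \<equiv> hor s (ver t x)"

text \<open>A plaquette is named by a corner \<open>x\<close> and the two signs leading from
  \<open>x\<close> into it. Each plaquette thus has four names, and facts proved at one corner carry
  over to the others by \<open>plaq_symm\<close>.\<close>

definition plaq :: "bool \<Rightarrow> bool \<Rightarrow> vert \<Rightarrow> edge set" where
  "plaq s t x = {hor_edge s x, ver_edge t x, hor_edge s (ver t x), ver_edge t (hor s x)}"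

text \<open>A proper 2-colouring because \<open>L\<close> is even: the wrap from
  \<open>L - 1\<close> to 0 changes the parity as well.\<close>

definition colour :: "vert \<Rightarrow> bool" where
  "colour x \<longleftrightarrow> even (fst x + snd x)"

lemma shift_True: "i < L \<Longrightarrow> shift True i = (if i + 1 = L then 0 else i + 1)"
  by (auto simp: shift_def)

lemma shift_False: "i < L \<Longrightarrow> shift False i = (if i = 0 then L - 1 else i - 1)"
  using L4 by (auto simp: shift_def mod_if)

lemma shift_lt [simp]: "i < L \<Longrightarrow> shift s i < L"
  by (auto simp: shift_def)

lemma shift_shift [simp]: "i < L \<Longrightarrow> s \<noteq> t \<Longrightarrow> shift t (shift s i) = i"
  using L4 by (cases s; cases t) (auto simp: shift_True shift_False)

lemma shift_ne [simp]: "i < L \<Longrightarrow> shift s i \<noteq> i" "i < L \<Longrightarrow> i \<noteq> shift s i"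
  using L4 by (cases s; auto simp: shift_True shift_False)+

lemma shift_eq_iff [simp]: "i < L \<Longrightarrow> shift s i = shift t i \<longleftrightarrow> s = t"
  using L4 by (cases s; cases t) (auto simp: shift_True shift_False split: if_splits)

lemma even_shift [simp]: "i < L \<Longrightarrow> even (shift s i) \<longleftrightarrow> odd i"
  using L4 evL by (cases s) (auto simp: shift_True shift_False)

lemma V_iff: "x \<in> V L \<longleftrightarrow> fst x < L \<and> snd x < L"
  by (cases x) (auto simp: V_def)

lemma finite_V [simp]: "finite (V L)"
  by (simp add: V_def)

lemma hor_V [simp]: "x \<in> V L \<Longrightarrow> hor s x \<in> V L"
  and ver_V [simp]: "x \<in> V L \<Longrightarrow> ver t x \<in> V L"
  by (auto simp: V_iff hor_def ver_def)

lemma hor_hor [simp]: "x \<in> V L \<Longrightarrow> s \<noteq> s' \<Longrightarrow> hor s' (hor s x) = x"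
  and ver_ver [simp]: "x \<in> V L \<Longrightarrow> t \<noteq> t' \<Longrightarrow> ver t' (ver t x) = x"
  by (auto simp: V_iff hor_def ver_def)

lemma ver_hor: "ver t (hor s x) = hor s (ver t x)"
  by (simp add: hor_def ver_def)

lemma diag_diag [simp]: "x \<in> V L \<Longrightarrow> s \<noteq> s' \<Longrightarrow> t \<noteq> t' \<Longrightarrow> diag s' t' (diag s t x) = x"
  by (metis hor_hor ver_V ver_hor ver_ver hor_V)

lemma colour_hor [simp]: "x \<in> V L \<Longrightarrow> colour (hor s x) \<longleftrightarrow> \<not> colour x"
  and colour_ver [simp]: "x \<in> V L \<Longrightarrow> colour (ver t x) \<longleftrightarrow> \<not> colour x"
  by (auto simp: V_iff hor_def ver_def colour_def)

lemma hor_ne: "x \<in> V L \<Longrightarrow> hor s x \<noteq> x"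
  and ver_ne: "x \<in> V L \<Longrightarrow> ver t x \<noteq> x"
  and hor_ne_ver: "x \<in> V L \<Longrightarrow> hor s x \<noteq> ver t x"
  and diag_ne: "x \<in> V L \<Longrightarrow> diag s t x \<noteq> x"
  by (auto simp: V_iff hor_def ver_def prod_eq_iff)

lemma hor_edge_hor: "x \<in> V L \<Longrightarrow> s \<noteq> s' \<Longrightarrow> hor_edge s' (hor s x) = hor_edge s x"
  and ver_edge_ver: "x \<in> V L \<Longrightarrow> t \<noteq> t' \<Longrightarrow> ver_edge t' (ver t x) = ver_edge t x"
  by (auto simp: hor_edge_def ver_edge_def)

lemma hor_edge_eq_iff [simp]: "x \<in> V L \<Longrightarrow> hor_edge s x = hor_edge s' x \<longleftrightarrow> s = s'"
  and ver_edge_eq_iff [simp]: "x \<in> V L \<Longrightarrow> ver_edge t x = ver_edge t' x \<longleftrightarrow> t = t'"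
  by (auto simp: hor_edge_def ver_edge_def doubleton_eq_iff hor_def ver_def V_iff prod_eq_iff)

lemma hor_edge_ne_ver_edge [simp]: "x \<in> V L \<Longrightarrow> y \<in> V L \<Longrightarrow> hor_edge s x \<noteq> ver_edge t y"
  "x \<in> V L \<Longrightarrow> y \<in> V L \<Longrightarrow> ver_edge t y \<noteq> hor_edge s x"
  by (auto simp: hor_edge_def ver_edge_def doubleton_eq_iff hor_def ver_def V_iff prod_eq_iff)

lemma hor_edge_in_E [simp]: "x \<in> V L \<Longrightarrow> hor_edge s x \<in> E L"
proof -
  have *: "hor_edge True y \<in> E L" if "y \<in> V L" for y
    using that by (auto simp: E_def hor_edge_def hor_def hedge_def shift_def)
  assume "x \<in> V L"
  then show ?thesis using *[of x] *[of "hor False x"] hor_edge_hor[of x False True]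
    by (cases s) auto
qed

lemma ver_edge_in_E [simp]: "x \<in> V L \<Longrightarrow> ver_edge s x \<in> E L"
proof -
  have *: "ver_edge True y \<in> E L" if "y \<in> V L" for y
    using that by (auto simp: E_def ver_edge_def ver_def vedge_def shift_def)
  assume "x \<in> V L"
  then show ?thesis using *[of x] *[of "ver False x"] ver_edge_ver[of x False True]
    by (cases s) auto
qed

lemma edge_cases:
  assumes "e \<in> E L"
  obtains y where "y \<in> V L" "e = hor_edge True y" | y where "y \<in> V L" "e = ver_edge True y"
  using assms by (auto simp: E_def hor_edge_def ver_edge_def hor_def ver_def hedge_def vedge_def shift_def)

lemma finite_E [simp]: "finite (E L)"
  by (simp add: E_def)

lemma incident_edges:
  assumes "x \<in> V L"
  shows "{e \<in> E L. x \<in> e} = {hor_edge s x, hor_edge (\<not> s) x, ver_edge t x, ver_edge (\<not> t) x}"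
proof (intro set_eqI iffI)
  fix e assume "e \<in> {e \<in> E L. x \<in> e}"
  then have e: "e \<in> E L" "x \<in> e" by auto
  from e(1) show "e \<in> {hor_edge s x, hor_edge (\<not> s) x, ver_edge t x, ver_edge (\<not> t) x}"
  proof (cases rule: edge_cases)
    case (1 y)
    then have "x = y \<or> x = hor True y" using e by (auto simp: hor_edge_def)
    then have "e = hor_edge True x \<or> e = hor_edge False x"
      using 1 hor_edge_hor[of y True False] by auto
    then show ?thesis by (cases s) auto
  next
    case (2 y)
    then have "x = y \<or> x = ver True y" using e by (auto simp: ver_edge_def)
    then have "e = ver_edge True x \<or> e = ver_edge False x"
      using 2 ver_edge_ver[of y True False] by auto
    then show ?thesis by (cases t) auto
  qed
next
  fix e assume "e \<in> {hor_edge s x, hor_edge (\<not> s) x, ver_edge t x, ver_edge (\<not> t) x}"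
  then have "e \<in> E L" "x \<in> e" using assms by auto (auto simp: hor_edge_def ver_edge_def)
  then show "e \<in> {e \<in> E L. x \<in> e}" by simp
qed

text \<open>The signs are free so that the four edges can be listed relative to whichever plaquette
  at \<open>x\<close> is being flipped.\<close>

lemma jdeg_eq:
  assumes "J \<subseteq> E L" "x \<in> V L"
  shows "jdeg J x = of_bool (hor_edge s x \<in> J) + of_bool (hor_edge (\<not> s) x \<in> J)
    + of_bool (ver_edge t x \<in> J) + of_bool (ver_edge (\<not> t) x \<in> J)"
proof -
  have "{e \<in> J. x \<in> e} = J \<inter> {hor_edge s x, hor_edge (\<not> s) x, ver_edge t x, ver_edge (\<not> t) x}"
    using incident_edges[OF assms(2), of s t] assms(1) by auto
  then show ?thesis
    using assms(2) by (auto simp: jdeg_def Int_insert_right)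
qed

section \<open>Plaquettes, flips and minimality\<close>

lemma plaq_symm:
  assumes "x \<in> V L"
  shows "plaq (\<not> s) t (hor s x) = plaq s t x" "plaq s (\<not> t) (ver t x) = plaq s t x"
    "plaq (\<not> s) (\<not> t) (diag s t x) = plaq s t x"
proof -
  have 1: "plaq (\<not> s) t (hor s x) = plaq s t x" if "x \<in> V L" for s t x
    using that unfolding plaq_def
    by (simp add: hor_edge_hor ver_hor insert_commute)
  have 2: "plaq s (\<not> t) (ver t x) = plaq s t x" if "x \<in> V L" for s t x
    using that unfolding plaq_def
    by (simp add: ver_edge_ver ver_hor[symmetric] insert_commute)
  show "plaq (\<not> s) t (hor s x) = plaq s t x" "plaq s (\<not> t) (ver t x) = plaq s t x"
    "plaq (\<not> s) (\<not> t) (diag s t x) = plaq s t x"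
    using 1 2 assms by simp_all
qed

lemma edge_in_plaq:
  assumes "x \<in> V L"
  shows "hor_edge u x \<in> plaq s t x \<longleftrightarrow> u = s" "ver_edge u x \<in> plaq s t x \<longleftrightarrow> u = t"
proof -
  have "hor_edge u x \<noteq> hor_edge s (ver t x)" "ver_edge u x \<noteq> ver_edge t (hor s x)"
    using assms by (auto simp: hor_edge_def ver_edge_def doubleton_eq_iff hor_def ver_def V_iff prod_eq_iff)
  then show "hor_edge u x \<in> plaq s t x \<longleftrightarrow> u = s" "ver_edge u x \<in> plaq s t x \<longleftrightarrow> u = t"
    using assms by (auto simp: plaq_def)
qed

lemma plaq_corners:
  assumes "x \<in> V L" "e \<in> plaq s t x"
  shows "e \<subseteq> {x, hor s x, ver t x, diag s t x}"
  using assms by (auto simp: plaq_def hor_edge_def ver_edge_def ver_hor)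

lemma plaq_subset_E: "x \<in> V L \<Longrightarrow> plaq s t x \<subseteq> E L"
  by (auto simp: plaq_def)

lemma finite_plaq [simp]: "finite (plaq s t x)"
  by (simp add: plaq_def)

lemma card_plaq: "x \<in> V L \<Longrightarrow> card (plaq s t x) = 4"
proof -
  assume x: "x \<in> V L"
  have "hor_edge s x \<noteq> hor_edge s (ver t x)" "ver_edge t x \<noteq> ver_edge t (hor s x)"
    using x by (auto simp: hor_edge_def ver_edge_def doubleton_eq_iff hor_def ver_def V_iff prod_eq_iff)
  then show ?thesis using x by (simp add: plaq_def)
qed

lemma pbound_eq_plaq: "pbound L f = plaq True True f"
  by (cases f) (auto simp: pbound_def plaq_def hor_edge_def ver_edge_def hor_def ver_def shift_def Let_def)

lemma plaq_is_pbound: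
  assumes "x \<in> V L"
  obtains f where "f \<in> V L" "plaq s t x = pbound L f"
proof -
  have "plaq s t x = plaq True t (if s then x else hor s x)"
    using plaq_symm(1)[OF assms, of s t] by (cases s) auto
  moreover obtain y where y: "y = (if s then x else hor s x)" "y \<in> V L" using assms by auto
  moreover have "plaq True t y = plaq True True (if t then y else ver t y)"
    using plaq_symm(2)[OF y(2), of True t] by (cases t) auto
  ultimately show ?thesis
    using that[of "if t then y else ver t y"] by (simp add: pbound_eq_plaq)
qed

text \<open>A plaquette contains exactly two edges at each of its corners and none at any other
  vertex, so all parities survive.\<close>

lemma join_flip:
  assumes J: "is_join L D J" and x: "x \<in> V L"
  shows "is_join L D (symdiff J (plaq s t x))"
proof -
  have JE: "J \<subseteq> E L" using J by (simp add: is_join_def)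
  have sub: "symdiff J (plaq s t x) \<subseteq> E L"
    using JE plaq_subset_E[OF x] by (auto simp: symdiff_def)
  have corner: "odd (jdeg (symdiff J (plaq s t x)) y) \<longleftrightarrow> odd (jdeg J y)"
    if "y \<in> V L" "plaq s t x = plaq s' t' y" for y s' t'
    unfolding that(2) using that sub JE
    by (simp add: jdeg_eq[where s = s' and t = t'] edge_in_plaq)
  have "odd (jdeg (symdiff J (plaq s t x)) y) \<longleftrightarrow> odd (jdeg J y)" if y: "y \<in> V L" for y
  proof (cases "y \<in> {x, hor s x, ver t x, diag s t x}")
    case True
    then consider "y = x" | "y = hor s x" | "y = ver t x" | "y = diag s t x" by blast
    then show ?thesis by cases (use corner[OF y] plaq_symm[OF x] in metis)+
  next
    case False
    then have "{e \<in> symdiff J (plaq s t x). y \<in> e} = {e \<in> J. y \<in> e}"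
      using plaq_corners[OF x] by auto
    then show ?thesis by (simp add: jdeg_def)
  qed
  then show ?thesis using J sub by (simp add: is_join_def)
qed

lemma min_join_flip:
  assumes "is_min_join L D J" "is_join L D J'" "card J' = card J"
  shows "is_min_join L D J'"
  using assms by (simp add: is_min_join_def)

text \<open>A flip trades the edges of \<open>J\<close> on the plaquette for the remaining ones of
  its four edges; with three or more in \<open>J\<close> it would make the join smaller.\<close>

lemma min_join_plaq:
  assumes "is_min_join L D J" "x \<in> V L"
  shows "card (J \<inter> plaq s t x) \<le> 2"
    "card (J \<inter> plaq s t x) = 2 \<Longrightarrow> card (symdiff J (plaq s t x)) = card J"
proof -
  have "J \<subseteq> E L" using assms by (auto simp: is_min_join_def is_join_def)
  then have fin: "finite J" by (rule finite_subset) simp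
  have eq: "card (symdiff J (plaq s t x)) + 2 * card (J \<inter> plaq s t x) = card J + 4"
    using card_symdiff[OF fin finite_plaq] card_plaq[OF assms(2)] by simp
  have "card J \<le> card (symdiff J (plaq s t x))"
    using assms join_flip by (auto simp: is_min_join_def)
  with eq show "card (J \<inter> plaq s t x) \<le> 2" by linarith
  show "card (symdiff J (plaq s t x)) = card J" if "card (J \<inter> plaq s t x) = 2"
    using eq that by linarith
qed


section \<open>Joins built from the edges at one colour class\<close>

lemma hit_same_colour:
  assumes "x \<in> V L" "y \<in> V L" "colour x = colour y"
  shows "x \<in> hor_edge s y \<longleftrightarrow> x = y" "x \<in> ver_edge s y \<longleftrightarrow> x = y"
  using assms by (auto simp: hor_edge_def ver_edge_def)

lemma hit_other_colour:
  assumes "y \<in> V L" "colour x \<noteq> colour y"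
  shows "x \<in> hor_edge s y \<longleftrightarrow> hor s y = x" "x \<in> ver_edge s y \<longleftrightarrow> ver s y = x"
  using assms by (auto simp: hor_edge_def ver_edge_def)

lemma hor_inj_on: "inj_on (hor s) (V L)"
  by (metis inj_onI hor_hor)

text \<open>Each vertex of colour \<open>c\<close> links two of its neighbours: the right and the left one or, at one
  vertex of each row, the right and the upper one, which ties the row to the next.\<close>

lemma comb_connected:
  fixes c :: bool
  defines "C \<equiv> {x \<in> V L. colour x = c}"
    and "q \<equiv> (\<lambda>x. if fst x < 2 then ver True x else hor False x)"
  assumes "u \<in> V L" "colour u \<noteq> c" "w \<in> V L" "colour w \<noteq> c"
  shows "(u, w) \<in> ((\<lambda>x. (hor True x, q x)) ` C \<union> (\<lambda>x. (q x, hor True x)) ` C)\<^sup>*"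
proof -
  let ?R = "(\<lambda>x. (hor True x, q x)) ` C \<union> (\<lambda>x. (q x, hor True x)) ` C"
  have "sym ?R" by (auto simp: sym_def)
  then have sym: "(b, a) \<in> ?R\<^sup>*" if "(a, b) \<in> ?R\<^sup>*" for a b
    using that by (meson sym_rtrancl symD)
  have link: "(hor True x, q x) \<in> ?R\<^sup>*" if "x \<in> V L" "colour x = c" for x
    using that by (intro r_into_rtrancl) (auto simp: C_def)
  \<comment> \<open>The vertex of row \<open>j\<close> in column 1 or 2 whose colour is not
    \<open>c\<close>; it serves as the root of its row.\<close>
  define r where "r j = (if even j = c then 1::nat else 2, j)" for j :: nat
  have row1: "((i, j), r j) \<in> ?R\<^sup>*" if "i < L" "j < L" "even (i + j) \<noteq> c" "1 \<le> i" for i j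
    using that
  proof (induction i rule: less_induct)
    case (less i)
    show ?case
    proof (cases "i \<le> 2")
      case True
      then have "i = 1 \<or> i = 2" using less.prems by linarith
      then have "(i, j) = r j" using less.prems by (auto simp: r_def)
      then show ?thesis by simp
    next
      case False
      define m where "m = i - 2"
      have i: "i = Suc (Suc m)" "1 \<le> m" using False by (auto simp: m_def)
      have "((i, j), (m, j)) \<in> ?R\<^sup>*"
        using link[of "(Suc m, j)"] i less.prems
        by (auto simp: V_iff colour_def hor_def q_def shift_True shift_False)
      moreover have "((m, j), r j) \<in> ?R\<^sup>*"
        using less.IH[of m] less.prems i by auto
      ultimately show ?thesis by (rule rtrancl_trans)
    qed
  qed
  have row: "((i, j), r j) \<in> ?R\<^sup>*" if "i < L" "j < L" "even (i + j) \<noteq> c" for i j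
  proof (cases "i = 0")
    case True
    \<comment> \<open>Column 0 is tied to its row across the wrap, by the link centred in column
      \<open>L - 1\<close>.\<close>
    have "((0, j), (L - 2, j)) \<in> ?R\<^sup>*"
    proof -
      define m where "m = L - 2"
      have m: "Suc (Suc m) = L" "2 \<le> m" using L4 by (auto simp: m_def)
      then have ends: "shift True (Suc m) = 0" "shift False (Suc m) = m" "Suc m < L"
        using shift_True[of "Suc m"] shift_False[of "Suc m"] by auto
      have "even (Suc m + j) = c" using evL m(1)[symmetric] that True by auto
      then show ?thesis
        using link[of "(Suc m, j)"] m(2) ends that
        by (simp add: V_iff colour_def hor_def q_def flip: m_def)
    qed
    moreover have "((L - 2, j), r j) \<in> ?R\<^sup>*"
      using row1[of "L - 2" j] L4 evL that True by auto
    ultimately show ?thesis unfolding True by (rule rtrancl_trans)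
  next
    case False
    then show ?thesis using row1 that by auto
  qed
  have up: "(r j, r (Suc j)) \<in> ?R\<^sup>*" if "Suc j < L" for j
  proof -
    let ?i = "if even j = c then 0::nat else 1"
    have "(r j, (?i, Suc j)) \<in> ?R\<^sup>*"
      using link[of "(?i, j)"] that L4
      by (auto simp: V_iff colour_def hor_def ver_def q_def r_def shift_True simp flip: numeral_2_eq_2 split: if_splits)
    moreover have "((?i, Suc j), r (Suc j)) \<in> ?R\<^sup>*"
      using row[of ?i "Suc j"] that L4 by auto
    ultimately show ?thesis by (rule rtrancl_trans)
  qed
  have base: "(r 0, r j) \<in> ?R\<^sup>*" if "j < L" for j
    using that
  proof (induction j)
    case (Suc j)
    then show ?case using up[of j] by (meson Suc_lessD rtrancl_trans)
  qed simp
  have root: "(v, r 0) \<in> ?R\<^sup>*" if "v \<in> V L" "colour v \<noteq> c" for v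
    using row[of "fst v" "snd v"] sym[OF base[of "snd v"]] that
    by (auto simp: V_iff colour_def intro: rtrancl_trans)
  show ?thesis
    using root[of u] sym[OF root[of w]] assms by (meson rtrancl_trans)
qed

text \<open>Start with the edges \<open>P x\<close> for \<open>x\<close> in
  \<open>D \<inter> C\<close>; the parities on \<open>C\<close> are then right. Adding both
  \<open>P x\<close> and \<open>Q x\<close> modulo 2, for \<open>x\<close> in a set
  \<open>X\<close>, keeps them right and changes the parities at \<open>p x\<close> and
  \<open>q x\<close>. By connectedness, \<open>X\<close> can be chosen to correct the other colour.
  For \<open>x\<close> in \<open>D\<close> this merely replaces \<open>P x\<close> by
  \<open>Q x\<close>, so if \<open>C \<subseteq> D\<close> each vertex of \<open>C\<close> still
  owns exactly one edge.\<close>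

lemma exists_join:
  fixes c :: bool
  defines "C \<equiv> {x \<in> V L. colour x = c}"
  assumes D: "D \<subseteq> V L" "even (card D)"
  shows "\<exists>J. is_join L D J \<and> (C \<subseteq> D \<longrightarrow> card J = card C)"
proof -
  let ?U = "{x \<in> V L. colour x \<noteq> c}"
  define p where "p = hor True"
  define q where "q = (\<lambda>x. if fst x < 2 then ver True x else hor False x)"
  define P where "P = hor_edge True"
  define Q where "Q = (\<lambda>x. if fst x < 2 then ver_edge True x else hor_edge False x)"
  have CV: "C \<subseteq> V L" and finC: "finite C" by (auto simp: C_def)
  have finD: "finite D" using D(1) by (rule finite_subset) simp
  have pC: "p x \<in> ?U" "q x \<in> ?U" "p x \<noteq> q x" if "x \<in> C" for x
    using that hor_ne_ver[of x] by (auto simp: C_def p_def q_def)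
       (auto simp: hor_def V_iff)
  have injp: "inj_on p C" using hor_inj_on CV unfolding p_def by (rule inj_on_subset)
  have hitC: "y \<in> P x \<longleftrightarrow> y = x" "y \<in> Q x \<longleftrightarrow> y = x" if "x \<in> C" "y \<in> C" for x y
    using that hit_same_colour[of y x] by (auto simp: C_def P_def Q_def)
  have hitU: "w \<in> P x \<longleftrightarrow> p x = w" "w \<in> Q x \<longleftrightarrow> q x = w" if "x \<in> C" "w \<in> ?U" for x w
    using that hit_other_colour[of x w] by (auto simp: C_def P_def Q_def p_def q_def)
  have injP: "inj_on P C" and injQ: "inj_on Q C"
    using hitC by (metis inj_onI)+
  have PQ: "P x \<noteq> Q y" if "x \<in> C" "y \<in> C" for x y
  proof
    assume eq: "P x = Q y"
    then have "x = y" using hitC that by metis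
    with eq show False using that by (auto simp: P_def Q_def C_def split: if_splits)
  qed
  \<comment> \<open>The vertices of the other colour at which the initial edges \<open>P x\<close>
    give the wrong parity. Since \<open>p\<close> is injective on \<open>C\<close>, the size of this
    set has the parity of \<open>card D\<close>.\<close>
  let ?S = "symdiff (p ` (D \<inter> C)) (D - C)"
  have "card (p ` (D \<inter> C)) = card (D \<inter> C)"
    using injp by (intro card_image) (auto intro: inj_on_subset)
  moreover have "card D = card (D \<inter> C) + card (D - C)"
    using finD by (metis card_Diff_subset_Int card_mono finite_Int inf_le1 le_add_diff_inverse)
  ultimately have "even (card ?S)"
    using odd_card_symdiff[of "p ` (D \<inter> C)" "D - C"] finD D(2) by auto
  moreover have "?S \<subseteq> ?U" using pC D(1) by (auto simp: symdiff_def C_def)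
  moreover have "finite ?S" using finC finD by simp
  moreover have "(u, w) \<in> ((\<lambda>x. (p x, q x)) ` C \<union> (\<lambda>x. (q x, p x)) ` C)\<^sup>*"
    if "u \<in> ?U" "w \<in> ?U" for u w
    using comb_connected[of u c w] that unfolding C_def p_def q_def by blast
  ultimately have "\<exists>X\<subseteq>C. \<forall>w. odd (card {x \<in> X. p x = w \<or> q x = w}) \<longleftrightarrow> w \<in> ?S"
    using finC pC(3) by (intro even_set_is_boundary[of C p q ?U ?S])
  then obtain X where X: "X \<subseteq> C" "\<And>w. odd (card {x \<in> X. p x = w \<or> q x = w}) \<longleftrightarrow> w \<in> ?S"
    by blast
  let ?Y = "symdiff (D \<inter> C) X"
  have YC: "?Y \<subseteq> C" using X by (auto simp: symdiff_def)
  have finX: "finite X" and finY: "finite ?Y"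
    using X(1) YC finC by (auto intro: finite_subset)
  have PQ': "P x \<noteq> Q z" if "x \<in> ?Y" "z \<in> X" for x z
    using PQ[of x z] subsetD[OF YC that(1)] subsetD[OF X(1) that(2)] by simp
  let ?J = "P ` ?Y \<union> Q ` X"
  have "?J \<subseteq> E L" using X(1) YC CV by (auto simp: P_def Q_def)
  moreover have "odd (jdeg ?J y) \<longleftrightarrow> y \<in> D" if y: "y \<in> V L" for y
  proof (cases "y \<in> C")
    case True
    have "{e \<in> ?J. y \<in> e} = (if y \<in> ?Y then {P y} else {}) \<union> (if y \<in> X then {Q y} else {})"
      using hitC[OF _ True] hitC[OF True True] X(1) YC by auto
    then show ?thesis using True PQ[of y y] by (auto simp: jdeg_def)
  next
    case False
    then have yU: "y \<in> ?U" using y by (auto simp: C_def)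
    have "{e \<in> ?J. y \<in> e} = P ` {x \<in> ?Y. p x = y} \<union> Q ` {x \<in> X. q x = y}"
      using hitU[OF _ yU] X(1) YC by auto
    also have "card \<dots> = card (P ` {x \<in> ?Y. p x = y}) + card (Q ` {x \<in> X. q x = y})"
    proof (rule card_Un_disjoint)
      show "finite (P ` {x \<in> ?Y. p x = y})" by (intro finite_imageI finite_subset[OF _ finY]) blast
      show "P ` {x \<in> ?Y. p x = y} \<inter> Q ` {x \<in> X. q x = y} = {}"
        using PQ' by blast
    qed (use finX in simp)
    also have "card (P ` {x \<in> ?Y. p x = y}) = card {x \<in> ?Y. p x = y}"
      using YC by (intro card_image inj_on_subset[OF injP]) auto
    also have "card (Q ` {x \<in> X. q x = y}) = card {x \<in> X. q x = y}"
      using X(1) by (intro card_image inj_on_subset[OF injQ]) auto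
    finally have deg: "jdeg ?J y = card {x \<in> ?Y. p x = y} + card {x \<in> X. q x = y}"
      by (simp add: jdeg_def)
    have "{x \<in> X. p x = y \<or> q x = y} = {x \<in> X. p x = y} \<union> {x \<in> X. q x = y}" by auto
    also have "card \<dots> = card {x \<in> X. p x = y} + card {x \<in> X. q x = y}"
    proof (rule card_Un_disjoint)
      show "{x \<in> X. p x = y} \<inter> {x \<in> X. q x = y} = {}"
        using X(1) pC(3) by fastforce
    qed (use finX in auto)
    finally have sum: "card {x \<in> X. p x = y \<or> q x = y} =
      card {x \<in> X. p x = y} + card {x \<in> X. q x = y}" .
    have "odd (card {x \<in> D \<inter> C. p x = y}) \<longleftrightarrow> y \<in> p ` (D \<inter> C)"
    proof (cases "y \<in> p ` (D \<inter> C)")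
      case True
      then obtain x where "x \<in> D \<inter> C" "p x = y" by auto
      then have "{x \<in> D \<inter> C. p x = y} = {x}"
        using injp by (auto dest: inj_onD)
      then show ?thesis using True by simp
    next
      case False
      then have "{x \<in> D \<inter> C. p x = y} = {}" by auto
      then show ?thesis using False by (metis card.empty even_zero)
    qed
    then show ?thesis
      using deg sum X(2)[of y] odd_card_filter_symdiff[of "D \<inter> C" X "\<lambda>x. p x = y"] finC finX False
      by auto
  qed
  ultimately have "is_join L D ?J" by (simp add: is_join_def)
  moreover have "card ?J = card C" if "C \<subseteq> D"
  proof -
    have Y: "?Y = C - X" using that X(1) by (auto simp: symdiff_def)
    have "card ?J = card (P ` ?Y) + card (Q ` X)"
    proof (rule card_Un_disjoint)
      show "P ` ?Y \<inter> Q ` X = {}" using PQ' by blast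
    qed (use finX finY in auto)
    also have "card (P ` ?Y) = card ?Y" using YC by (intro card_image inj_on_subset[OF injP])
    also have "card (Q ` X) = card X" using X(1) by (intro card_image inj_on_subset[OF injQ])
    finally show ?thesis
      using Y X(1) finC by (metis card_Diff_subset card_mono finX le_add_diff_inverse2)
  qed
  ultimately show ?thesis by blast
qed

text \<open>No edge has two ends in the class, so the degrees there sum to at most
  \<open>card J\<close>, which by \<open>exists_join\<close> is at most the size of the class. All
  these degrees are odd, hence all are 1.\<close>

lemma jdeg_eq_1_if_colour_class_subset:
  assumes min: "is_min_join L D J" and D: "D \<subseteq> V L" "even (card D)"
    and sub: "{x \<in> V L. colour x = c} \<subseteq> D" and v: "v \<in> V L" "colour v = c"
  shows "jdeg J v = 1"
proof -
  let ?C = "{x \<in> V L. colour x = c}"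
  have JE: "J \<subseteq> E L" and odd: "\<And>x. x \<in> ?C \<Longrightarrow> odd (jdeg J x)"
    using min sub by (auto simp: is_min_join_def is_join_def)
  have finJ: "finite J" using JE by (rule finite_subset) simp
  have disj: "{e \<in> J. x \<in> e} \<inter> {e \<in> J. y \<in> e} = {}" if "x \<in> ?C" "y \<in> ?C" "x \<noteq> y" for x y
  proof -
    have False if e: "e \<in> E L" "x \<in> e" "y \<in> e" for e
      using incident_edges[of x True True] hit_same_colour[of y x] e \<open>x \<in> ?C\<close> \<open>y \<in> ?C\<close> \<open>x \<noteq> y\<close>
      by blast
    then show ?thesis using JE by blast
  qed
  have "(\<Sum>x\<in>?C. jdeg J x) = card (\<Union>x\<in>?C. {e \<in> J. x \<in> e})"
    unfolding jdeg_def using finJ disj by (subst card_UN_disjoint) auto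
  also have "\<dots> \<le> card J" using finJ by (intro card_mono) auto
  also have "\<dots> \<le> card ?C"
    using exists_join[OF D, of c] min sub by (auto simp: is_min_join_def)
  finally have le: "(\<Sum>x\<in>?C. jdeg J x) \<le> card ?C" .
  have ge1: "1 \<le> jdeg J x" if "x \<in> ?C" for x
    using odd[OF that] by (cases "jdeg J x") auto
  show ?thesis
  proof (rule ccontr)
    assume "jdeg J v \<noteq> 1"
    then have "1 < jdeg J v" using ge1[of v] v by auto
    then have "(\<Sum>x\<in>?C. 1) < (\<Sum>x\<in>?C. jdeg J x)"
      using v ge1 by (intro sum_strict_mono_ex1 bexI[of _ v]) auto
    with le show False by simp
  qed
qed


section \<open>Defects and how a flip moves them\<close>

text \<open>In a \<open>D\<close>-join the degrees on \<open>D\<close> are odd and at most 4, so a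
  degree other than 1 is 3.\<close>

definition defects :: "vert set \<Rightarrow> edge set \<Rightarrow> nat" where
  "defects D J = card {v \<in> D. jdeg J v \<noteq> 1}"

text \<open>Flipping the plaquette in the diagonal direction \<open>(s, t)\<close> moves such a defect across it.\<close>

definition tee :: "edge set \<Rightarrow> vert \<Rightarrow> bool \<Rightarrow> bool \<Rightarrow> bool" where
  "tee J x s t \<longleftrightarrow> jdeg J x = 3 \<and> hor_edge s x \<in> J \<and> ver_edge t x \<in> J"

lemma tee_exists:
  assumes "J \<subseteq> E L" "x \<in> V L" "jdeg J x = 3"
  shows "\<exists>s t. tee J x s t"
proof -
  have "\<exists>s. hor_edge s x \<in> J" "\<exists>t. ver_edge t x \<in> J"
    using jdeg_eq[OF assms(1,2), of True True] assms(3)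
    by (auto simp: of_bool_def split: if_splits)
  then show ?thesis using assms(3) by (auto simp: tee_def)
qed

lemma jdeg_flip_corner:
  assumes "J \<subseteq> E L" "y \<in> V L"
  shows "jdeg (symdiff J (plaq s t y)) y = of_bool (hor_edge s y \<notin> J) + of_bool (hor_edge (\<not> s) y \<in> J)
    + of_bool (ver_edge t y \<notin> J) + of_bool (ver_edge (\<not> t) y \<in> J)"
proof -
  have "symdiff J (plaq s t y) \<subseteq> E L"
    using assms plaq_subset_E[of y] by (auto simp: symdiff_def)
  then show ?thesis
    using assms by (simp add: jdeg_eq[where s = s and t = t] edge_in_plaq)
qed

text \<open>The two edges at \<open>x\<close> already exhaust the bound of two edges per plaquette,
  so the two sides at the opposite corner are missing from \<open>J\<close>.\<close>

lemma min_join_tee: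
  assumes min: "is_min_join L D J" and x: "x \<in> V L" and tee: "tee J x s t"
  shows "J \<inter> plaq s t x = {hor_edge s x, ver_edge t x}"
    "hor_edge (\<not> s) (diag s t x) \<notin> J" "ver_edge (\<not> t) (diag s t x) \<notin> J"
    "card (symdiff J (plaq s t x)) = card J"
proof -
  let ?c = "diag s t x"
  have two: "card {hor_edge s x, ver_edge t x} = 2" using x by simp
  have sub: "{hor_edge s x, ver_edge t x} \<subseteq> J \<inter> plaq s t x"
    using tee x by (auto simp: tee_def edge_in_plaq)
  have "finite (J \<inter> plaq s t x)" "card (J \<inter> plaq s t x) \<le> card {hor_edge s x, ver_edge t x}"
    using min_join_plaq(1)[OF min x, of s t] two by simp_all
  from card_seteq[OF this(1) sub this(2)]
  show eq: "J \<inter> plaq s t x = {hor_edge s x, ver_edge t x}" by (rule sym)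
  have notx: "x \<notin> hor_edge (\<not> s) ?c" "x \<notin> ver_edge (\<not> t) ?c"
    using hit_same_colour[of x ?c "\<not> s"] hit_same_colour[of x ?c "\<not> t"]
      diag_ne[OF x, of s t] x by (metis colour_hor colour_ver hor_V ver_V)+
  have "hor_edge (\<not> s) ?c \<in> plaq s t x" "ver_edge (\<not> t) ?c \<in> plaq s t x"
    using edge_in_plaq[of ?c _ "\<not> s" "\<not> t"] plaq_symm(3)[OF x] x by auto
  then show "hor_edge (\<not> s) ?c \<notin> J" "ver_edge (\<not> t) ?c \<notin> J"
    using eq notx by (metis IntI hor_edge_def insertE insertI1 singletonD ver_edge_def)+
  show "card (symdiff J (plaq s t x)) = card J"
    using min_join_plaq(2)[OF min x] eq two by simp
qed

text \<open>Two edges leave at \<open>x\<close>, two enter at the opposite corner, and at the other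
  two corners one edge is exchanged for another.\<close>

lemma tee_flip_jdeg:
  assumes min: "is_min_join L D J" and x: "x \<in> V L" and tee: "tee J x s t" and y: "y \<in> V L"
  shows "jdeg (symdiff J (plaq s t x)) y =
    (if y = x then 1 else if y = diag s t x then jdeg J y + 2 else jdeg J y)"
proof -
  let ?J = "symdiff J (plaq s t x)" and ?c = "diag s t x"
  have JE: "J \<subseteq> E L" using min by (auto simp: is_min_join_def is_join_def)
  note J = jdeg_eq[OF JE] and F = jdeg_flip_corner[OF JE]
  note c = min_join_tee(2,3)[OF min x tee]
  have at_x: "hor_edge s x \<in> J" "ver_edge t x \<in> J" "jdeg J x = 3" using tee by (auto simp: tee_def)
  have ne: "?c \<noteq> x" "hor s x \<noteq> x" "ver t x \<noteq> x" "hor s x \<noteq> ?c" "ver t x \<noteq> ?c"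
    using x diag_ne hor_ne ver_ne by (metis ver_V hor_V ver_hor)+
  consider "y = x" | "y = ?c" | "y = hor s x" | "y = ver t x"
    | "y \<notin> {x, hor s x, ver t x, ?c}" by blast
  then show ?thesis
  proof cases
    case 1
    then show ?thesis using F[OF x, of s t] J[OF x, of s t] at_x by simp
  next
    case 2
    then show ?thesis
      using F[of ?c "\<not> s" "\<not> t"] J[of ?c "\<not> s" "\<not> t"] c ne(1) x plaq_symm(3)[OF x, of s t]
      by simp
  next
    case 3
    have "hor_edge (\<not> s) y \<in> J" "ver_edge t y \<notin> J"
      using 3 at_x c x hor_edge_hor[of x s "\<not> s"] ver_edge_ver[of "hor s x" t "\<not> t"] by (auto simp: ver_hor)
    then show ?thesis
      using 3 F[of y "\<not> s" t] J[of y "\<not> s" t] ne x plaq_symm(1)[OF x, of s t] by simp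
  next
    case 4
    have "hor_edge s y \<notin> J" "ver_edge (\<not> t) y \<in> J"
      using 4 at_x c x hor_edge_hor[of "ver t x" s "\<not> s"] ver_edge_ver[of x t "\<not> t"] by auto
    then show ?thesis
      using 4 F[of y s "\<not> t"] J[of y s "\<not> t"] ne x plaq_symm(2)[OF x, of s t] by simp
  next
    case 5
    then have "{e \<in> ?J. y \<in> e} = {e \<in> J. y \<in> e}" using plaq_corners[OF x] by auto
    then show ?thesis using 5 by (simp add: jdeg_def)
  qed
qed

text \<open>At a vertex of degree 1 the edge is vertical, at a vertex of degree 3 the bar of the T is.
  Moving a defect keeps this at all vertices of its colour, because at both ends of the move one
  horizontal and one vertical edge are removed or added together.\<close>

definition vertical :: "edge set \<Rightarrow> vert \<Rightarrow> bool" where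
  "vertical J y \<longleftrightarrow> (of_bool (hor_edge True y \<in> J) + of_bool (hor_edge False y \<in> J) :: nat)
    < of_bool (ver_edge True y \<in> J) + of_bool (ver_edge False y \<in> J)"

lemma vertical_eq:
  "vertical J y \<longleftrightarrow> (of_bool (hor_edge s y \<in> J) + of_bool (hor_edge (\<not> s) y \<in> J) :: nat)
    < of_bool (ver_edge t y \<in> J) + of_bool (ver_edge (\<not> t) y \<in> J)"
  by (cases s; cases t) (auto simp: vertical_def)

text \<open>The only corners of the plaquette with the colour of \<open>x\<close> are
  \<open>x\<close> and the one opposite.\<close>

lemma far_edges_flip:
  assumes "x \<in> V L" "y \<in> V L" "colour y = colour x" "y \<noteq> x" "y \<noteq> diag s t x"
  shows "hor_edge u y \<in> symdiff J (plaq s t x) \<longleftrightarrow> hor_edge u y \<in> J"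
    "ver_edge u y \<in> symdiff J (plaq s t x) \<longleftrightarrow> ver_edge u y \<in> J"
proof -
  have "y \<notin> e" if "e \<in> plaq s t x" for e
    using plaq_corners[OF assms(1) that] assms by auto
  then have "hor_edge u y \<notin> plaq s t x" "ver_edge u y \<notin> plaq s t x"
    by (auto simp: hor_edge_def ver_edge_def)
  then show "hor_edge u y \<in> symdiff J (plaq s t x) \<longleftrightarrow> hor_edge u y \<in> J"
    "ver_edge u y \<in> symdiff J (plaq s t x) \<longleftrightarrow> ver_edge u y \<in> J" by auto
qed

lemma tee_flip_vertical:
  assumes min: "is_min_join L D J" and x: "x \<in> V L" and tee: "tee J x s t"
    and y: "y \<in> V L" "colour y = colour x"
  shows "vertical (symdiff J (plaq s t x)) y = vertical J y"
proof -
  let ?c = "diag s t x"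
  consider "y = x" | "y = ?c" | "y \<noteq> x" "y \<noteq> ?c" by blast
  then show ?thesis
  proof cases
    case 1
    then show ?thesis
      using tee x unfolding vertical_eq[where s = s and t = t] by (simp add: edge_in_plaq tee_def)
  next
    case 2
    then show ?thesis
      using min_join_tee(2,3)[OF min x tee] x plaq_symm(3)[OF x, of s t, symmetric]
      unfolding vertical_eq[where s = "\<not> s" and t = "\<not> t"] by (simp add: edge_in_plaq)
  next
    case 3
    then show ?thesis using far_edges_flip[OF x y] by (simp add: vertical_def)
  qed
qed

end

text \<open>\<open>G\<close> stands for the minimum joins reachable from a given one by plaquette flips.\<close>

locale stuck = torus +
  fixes D :: "vert set" and G :: "edge set \<Rightarrow> bool"
    and J0 :: "edge set" and x0 :: vert and s0 t0 :: bool
  assumes D_sub: "D \<subseteq> V L"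
    and G_min: "G J \<Longrightarrow> is_min_join L D J"
    and G_flip: "G J \<Longrightarrow> f \<in> V L \<Longrightarrow> card (symdiff J (pbound L f)) = card J \<Longrightarrow>
      G (symdiff J (pbound L f))"
    and G_opt: "G J \<Longrightarrow> defects D J0 \<le> defects D J"
    and G_J0: "G J0" and x0: "x0 \<in> D" and tee0: "tee J0 x0 s0 t0"
begin

section \<open>The endless walk of a defect\<close>

text \<open>A T has two corners. At the new defect one of them is the plaquette just crossed; the
  walk takes the other, whose signs depend on the edge that was present before the flip.\<close>

primrec state :: "nat \<Rightarrow> edge set \<times> vert \<times> bool \<times> bool" where
  "state 0 = (J0, x0, s0, t0)"
| "state (Suc n) = (case state n of (J, x, s, t) \<Rightarrow>
    (symdiff J (plaq s t x), diag s t x,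
      if ver_edge t (diag s t x) \<in> J then (\<not> s, t) else (s, \<not> t)))"

definition "Js n = fst (state n)"
definition "xs n = fst (snd (state n))"
definition "ss n = fst (snd (snd (state n)))"
definition "ts n = snd (snd (snd (state n)))"

lemma state_Suc:
  "Js (Suc n) = symdiff (Js n) (plaq (ss n) (ts n) (xs n))"
  "xs (Suc n) = diag (ss n) (ts n) (xs n)"
  "ss (Suc n) = (if ver_edge (ts n) (xs (Suc n)) \<in> Js n then \<not> ss n else ss n)"
  "ts (Suc n) = (if ver_edge (ts n) (xs (Suc n)) \<in> Js n then ts n else \<not> ts n)"
  by (auto simp: Js_def xs_def ss_def ts_def split: prod.splits)

text \<open>Two edges at \<open>c\<close> are missing, so its degree is at most 2. Were
  \<open>c\<close> not a degree-1 vertex of \<open>D\<close>, parity would put it outside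
  \<open>D\<close>, and the flip would remove the defect at \<open>x\<close> without creating one,
  against \<open>G_opt\<close>. So \<open>c\<close> takes the place of \<open>x\<close> as a
  defect.\<close>

lemma defect_moves:
  assumes G: "G J" and opt: "defects D J \<le> defects D J0" and x: "x \<in> D" and tee: "tee J x s t"
  defines "c \<equiv> diag s t x" and "J' \<equiv> symdiff J (plaq s t x)"
  shows "G J'" "defects D J' \<le> defects D J0" "c \<in> D" "jdeg J c = 1"
proof -
  have xV: "x \<in> V L" using x D_sub by auto
  have cV: "c \<in> V L" using xV by (simp add: c_def)
  note min = G_min[OF G]
  have JE: "J \<subseteq> E L" and odd: "\<And>v. v \<in> V L \<Longrightarrow> odd (jdeg J v) \<longleftrightarrow> v \<in> D"
    using min by (auto simp: is_min_join_def is_join_def)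
  obtain f where "f \<in> V L" "plaq s t x = pbound L f" using plaq_is_pbound[OF xV] .
  then show G': "G J'"
    using G_flip[OF G] min_join_tee(4)[OF min xV tee] by (simp add: J'_def)
  note deg = tee_flip_jdeg[OF min xV tee, folded J'_def c_def]
  have finD: "finite D" using D_sub by (rule finite_subset) simp
  have xdef: "x \<in> {v \<in> D. jdeg J v \<noteq> 1}" using x tee by (simp add: tee_def)
  show c: "c \<in> D" and c1: "jdeg J c = 1"
  proof -
    have "c \<in> D \<and> jdeg J c = 1"
    proof (rule ccontr)
      assume not: "\<not> (c \<in> D \<and> jdeg J c = 1)"
      have "jdeg J c \<le> 2"
        using jdeg_eq[OF JE cV, of s t] min_join_tee(2,3)[OF min xV tee] by (simp add: c_def)
      then have "c \<notin> D"
        using not odd[OF cV] by (metis One_nat_def even_numeral le_neq_implies_less less_2_cases odd_pos less_numeral_extra(3))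
      then have "{v \<in> D. jdeg J' v \<noteq> 1} \<subseteq> {v \<in> D. jdeg J v \<noteq> 1} - {x}"
        using deg D_sub by (auto split: if_splits)
      then have "defects D J' \<le> card ({v \<in> D. jdeg J v \<noteq> 1} - {x})"
        unfolding defects_def using finD by (intro card_mono) auto
      also have "\<dots> < defects D J"
        unfolding defects_def using finD xdef by (intro card_Diff1_less) auto
      finally show False using G_opt[OF G'] opt by simp
    qed
    then show "c \<in> D" "jdeg J c = 1" by auto
  qed
  have "{v \<in> D. jdeg J' v \<noteq> 1} \<subseteq> insert c ({v \<in> D. jdeg J v \<noteq> 1} - {x})"
    using deg D_sub by (auto split: if_splits)
  then have "defects D J' \<le> card (insert c ({v \<in> D. jdeg J v \<noteq> 1} - {x}))"
    unfolding defects_def using finD by (intro card_mono) auto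
  also have "\<dots> \<le> Suc (card ({v \<in> D. jdeg J v \<noteq> 1} - {x}))"
    by (rule card_insert_le_m1) auto
  also have "\<dots> = defects D J"
    unfolding defects_def using finD xdef by (intro card_Suc_Diff1) auto
  finally show "defects D J' \<le> defects D J0" using opt by simp
qed

lemma state_inv: "G (Js n) \<and> defects D (Js n) \<le> defects D J0 \<and> xs n \<in> D \<and> tee (Js n) (xs n) (ss n) (ts n)"
proof (induction n)
  case 0
  show ?case using G_J0 x0 tee0 by (simp add: Js_def xs_def ss_def ts_def)
next
  case (Suc n)
  let ?J = "Js n" and ?x = "xs n" and ?s = "ss n" and ?t = "ts n"
  let ?c = "diag ?s ?t ?x"
  have inv: "G ?J" "defects D ?J \<le> defects D J0" "?x \<in> D" "tee ?J ?x ?s ?t" using Suc by auto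
  note move = defect_moves[OF inv]
  have xV: "?x \<in> V L" and cV: "?c \<in> V L" using inv(3) D_sub by auto
  note min = G_min[OF inv(1)]
  have JE: "?J \<subseteq> E L" using min by (auto simp: is_min_join_def is_join_def)
  have "jdeg (Js (Suc n)) ?c = 3"
    using tee_flip_jdeg[OF min xV inv(4) cV] move(4) diag_ne[OF xV] by (simp add: state_Suc)
  moreover have "hor_edge (ss (Suc n)) ?c \<in> Js (Suc n) \<and> ver_edge (ts (Suc n)) ?c \<in> Js (Suc n)"
  proof -
    note e = min_join_tee(2,3)[OF min xV inv(4)]
    have one: "hor_edge ?s ?c \<in> ?J \<longleftrightarrow> ver_edge ?t ?c \<notin> ?J"
      using jdeg_eq[OF JE cV, of ?s ?t] move(4) e
      by (cases "hor_edge ?s ?c \<in> ?J"; cases "ver_edge ?t ?c \<in> ?J") simp_all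
    have at_c: "hor_edge u ?c \<in> plaq ?s ?t ?x \<longleftrightarrow> u \<noteq> ?s" "ver_edge u ?c \<in> plaq ?s ?t ?x \<longleftrightarrow> u \<noteq> ?t" for u
      using edge_in_plaq[OF cV, of u "\<not> ?s" "\<not> ?t"] plaq_symm(3)[OF xV, of ?s ?t] by auto
    show ?thesis
      using one e at_c by (cases "ver_edge ?t ?c \<in> ?J") (simp_all add: state_Suc)
  qed
  ultimately show ?case using move(1-3) by (simp add: tee_def state_Suc)
qed

lemma
  shows Js_min: "is_min_join L D (Js n)" and xs_D: "xs n \<in> D" and xs_V: "xs n \<in> V L"
    and xs_tee: "tee (Js n) (xs n) (ss n) (ts n)"
  using state_inv[of n] G_min D_sub by auto

lemma Js_sub: "Js n \<subseteq> E L"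
  using Js_min[of n] by (auto simp: is_min_join_def is_join_def)

text \<open>Just before the defect arrives, the vertex has a single edge, and this edge points away
  from the plaquette about to be crossed.\<close>

lemma entry:
  "hor_edge (\<not> ss n) (xs (Suc n)) \<notin> Js n" "ver_edge (\<not> ts n) (xs (Suc n)) \<notin> Js n"
  "hor_edge (ss n) (xs (Suc n)) \<in> Js n \<longleftrightarrow> ver_edge (ts n) (xs (Suc n)) \<notin> Js n"
proof -
  show e: "hor_edge (\<not> ss n) (xs (Suc n)) \<notin> Js n" "ver_edge (\<not> ts n) (xs (Suc n)) \<notin> Js n"
    using min_join_tee(2,3)[OF Js_min xs_V xs_tee] by (auto simp: state_Suc)
  have "jdeg (Js n) (xs (Suc n)) = 1"
    using defect_moves(4)[of "Js n" "xs n" "ss n" "ts n"] state_inv[of n] by (simp add: state_Suc(2))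
  then show "hor_edge (ss n) (xs (Suc n)) \<in> Js n \<longleftrightarrow> ver_edge (ts n) (xs (Suc n)) \<notin> Js n"
    using jdeg_eq[OF Js_sub[of n] xs_V[of "Suc n"], of "ss n" "ts n"] e
    by (cases "hor_edge (ss n) (xs (Suc n)) \<in> Js n"; cases "ver_edge (ts n) (xs (Suc n)) \<in> Js n") simp_all
qed

lemma xs_colour: "colour (xs n) = colour x0"
proof (induction n)
  case 0
  show ?case by (simp add: xs_def)
next
  case (Suc n)
  then show ?case using xs_V[of n] by (simp add: state_Suc(2))
qed

lemma vertical_Js:
  assumes "y \<in> V L" "colour y = colour x0"
  shows "vertical (Js n) y = vertical J0 y"
proof (induction n)
  case 0
  show ?case by (simp add: Js_def)
next
  case (Suc n)
  then show ?case
    using tee_flip_vertical[OF Js_min xs_V xs_tee assms(1), of n] assms xs_colour[of n]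
    by (simp add: state_Suc(1))
qed

text \<open>Since the axis at a vertex never changes, the turn made there depends only on the vertex
  and on \<open>J0\<close>, not on the time of the visit.\<close>

lemma turn:
  "ss (Suc n) = (if vertical J0 (xs (Suc n)) then \<not> ss n else ss n)"
  "ts (Suc n) = (if vertical J0 (xs (Suc n)) then ts n else \<not> ts n)"
proof -
  have "vertical J0 (xs (Suc n)) \<longleftrightarrow> vertical (Js n) (xs (Suc n))"
    using vertical_Js[OF xs_V xs_colour] by blast
  also have "\<dots> \<longleftrightarrow> ver_edge (ts n) (xs (Suc n)) \<in> Js n"
    using entry[of n] by (auto simp: vertical_eq[where s = "ss n" and t = "ts n"])
  finally show "ss (Suc n) = (if vertical J0 (xs (Suc n)) then \<not> ss n else ss n)"
    "ts (Suc n) = (if vertical J0 (xs (Suc n)) then ts n else \<not> ts n)"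
    by (simp_all add: state_Suc(3,4))
qed

lemma xs_back: "xs n = diag (\<not> ss n) (\<not> ts n) (xs (Suc n))"
  using xs_V[of n] by (simp add: state_Suc(2))

text \<open>A retraced stretch shrinks from both ends until it contradicts the fact that every step turns
  by a right angle.\<close>

lemma no_reversal:
  assumes "i \<le> j" "xs j = xs (Suc i)" "ss j = (\<not> ss i)" "ts j = (\<not> ts i)"
  shows False
  using assms
proof (induction "j - i" arbitrary: i j rule: less_induct)
  case less
  consider "j = i" | "j = Suc i" | "Suc (Suc i) \<le> j" using less.prems(1) by linarith
  then show False
  proof cases
    case 1
    then show False using less.prems by auto
  next
    case 2
    then show False using less.prems turn[of i] by (auto split: if_splits)
  next
    case 3
    then obtain k where k: "j = Suc k" "Suc i \<le> k" by (cases j) auto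
    \<comment> \<open>The vertex at \<open>j\<close> is the one at \<open>Suc i\<close>, so both
      visits flip the same sign, and the directions one step further in are again opposite.\<close>
    have s: "ss k = (\<not> ss (Suc i))" "ts k = (\<not> ts (Suc i))"
      using less.prems turn[of i] turn[of k] k(1) by (auto split: if_splits)
    have "xs k = diag (\<not> ss k) (\<not> ts k) (xs j)" using xs_back[of k] k(1) by simp
    then have "xs k = xs (Suc (Suc i))"
      using s less.prems(2) by (simp add: state_Suc(2))
    moreover have "k - Suc i < j - i" using k by linarith
    ultimately show False using less.hyps[OF _ k(2) _ s] by blast
  qed
qed

text \<open>A move touches edges at vertices of this colour only at its two ends. The comparison
  starts at \<open>Suc n\<close> because the move from time \<open>n\<close> may itself leave
  \<open>y\<close>.\<close>

lemma edges_wait: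
  assumes "n < m" "m \<le> k" "\<And>l. n < l \<Longrightarrow> l \<le> k \<Longrightarrow> xs l \<noteq> y" "y \<in> V L" "colour y = colour x0"
  shows "(hor_edge u y \<in> Js m \<longleftrightarrow> hor_edge u y \<in> Js (Suc n)) \<and> (ver_edge u y \<in> Js m \<longleftrightarrow> ver_edge u y \<in> Js (Suc n))"
  using assms(1,2)
proof (induction m)
  case (Suc m)
  show ?case
  proof (cases "m = n")
    case False
    then have "n < m" "Suc m \<le> k" using Suc.prems by auto
    then have "xs m \<noteq> y" "xs (Suc m) \<noteq> y" using assms(3) by auto
    then show ?thesis
      using far_edges_flip[OF xs_V[of m] assms(4), of "ss m" "ts m" u "Js m"] Suc.IH \<open>n < m\<close> \<open>Suc m \<le> k\<close>
        assms(5) xs_colour[of m]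
      by (simp add: state_Suc(1,2))
  qed simp
qed simp

text \<open>Leaving \<open>xs n\<close> turns its edge around, so the next visit runs in the opposite direction along
  the same axis. It cannot retrace the previous one, hence it passes on the other side, and the two
  visits together use all four diagonal neighbours.\<close>

lemma revisit:
  assumes n: "0 < n" and k: "n < Suc k" "xs (Suc k) = xs n"
    and first: "\<And>l. n < l \<Longrightarrow> l \<le> k \<Longrightarrow> xs l \<noteq> xs n"
  shows "\<exists>m. n - 1 \<le> m \<and> xs m = diag u v (xs n)"
proof -
  let ?x = "xs n" and ?s = "ss n" and ?t = "ts n"
  obtain m where m: "n = Suc m" using n by (cases n) auto
  have "k \<noteq> n" using diag_ne[OF xs_V[of n]] k(2) state_Suc(2)[of n] by metis
  then have nk: "n < k" using k by auto
  note A = vertical_Js[OF xs_V[of n] xs_colour[of n], of n]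
  have deg3: "jdeg (Js n) ?x = 3" "hor_edge ?s ?x \<in> Js n" "ver_edge ?t ?x \<in> Js n"
    using xs_tee[of n] by (auto simp: tee_def)
  then have third: "hor_edge (\<not> ?s) ?x \<in> Js n \<longleftrightarrow> ver_edge (\<not> ?t) ?x \<notin> Js n"
    using jdeg_eq[OF Js_sub[of n] xs_V[of n], of ?s ?t]
    by (cases "hor_edge (\<not> ?s) ?x \<in> Js n"; cases "ver_edge (\<not> ?t) ?x \<in> Js n") simp_all
  then have arrow: "ver_edge (\<not> ?t) ?x \<in> Js n \<longleftrightarrow> vertical J0 ?x"
    using A deg3 by (auto simp: vertical_eq[where s = ?s and t = ?t])
  \<comment> \<open>Leaving removes the two edges of the corner used, so only the third edge of the
    T is left until the walk returns.\<close>
  have after: "hor_edge ?s ?x \<notin> Js k" "ver_edge ?t ?x \<notin> Js k"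
    "ver_edge (\<not> ?t) ?x \<in> Js k \<longleftrightarrow> vertical J0 ?x" "hor_edge (\<not> ?s) ?x \<in> Js k \<longleftrightarrow> \<not> vertical J0 ?x"
    using edges_wait[OF nk order_refl first xs_V[of n] xs_colour[of n]] arrow third deg3
      edge_in_plaq[OF xs_V[of n], of _ ?s ?t]
    by (auto simp: state_Suc(1))
  have in_k: "hor_edge (ss k) ?x \<in> Js k \<longleftrightarrow> ver_edge (ts k) ?x \<notin> Js k"
    "hor_edge (\<not> ss k) ?x \<notin> Js k" "ver_edge (\<not> ts k) ?x \<notin> Js k"
    using entry[of k] k(2) by auto
  have xk: "xs k = diag (\<not> ss k) (\<not> ts k) ?x" using xs_back[of k] k(2) by simp
  have notrev: "\<not> (ss k = (\<not> ?s) \<and> ts k = (\<not> ?t))"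
  proof
    assume rev: "ss k = (\<not> ?s) \<and> ts k = (\<not> ?t)"
    then have "xs k = xs (Suc n)" using xk by (simp add: state_Suc(2))
    then show False using no_reversal[of n k] rev nk by auto
  qed
  \<comment> \<open>The remaining edge must lie ahead on arrival, which reverses the sign along its
    axis; reversing the other sign too would retrace the departure.\<close>
  have dirs: "if vertical J0 ?x then ts k = (\<not> ?t) \<and> ss k = ?s else ss k = (\<not> ?s) \<and> ts k = ?t"
    using after in_k notrev by (cases "vertical J0 ?x"; cases "ss k = ?s"; cases "ts k = ?t") auto
  have pm: "xs m = diag (\<not> ss m) (\<not> ts m) ?x" using xs_back[of m] m by simp
  have sm: "ss m = (if vertical J0 ?x then \<not> ?s else ?s)" "ts m = (if vertical J0 ?x then ?t else \<not> ?t)"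
    using turn[of m] m by auto
  have sk: "ss (Suc k) = (\<not> ?s)" "ts (Suc k) = (\<not> ?t)"
    using turn[of k] k(2) dirs by (auto split: if_splits)
  \<comment> \<open>The four diagonal neighbours are the predecessors and the successors of the two
    visits.\<close>
  have 1: "xs (Suc n) = diag ?s ?t ?x" by (simp add: state_Suc(2))
  have 2: "xs (Suc (Suc k)) = diag (\<not> ?s) (\<not> ?t) ?x"
    using state_Suc(2)[of "Suc k"] k(2) sk by simp
  have 3: "diag ?s (\<not> ?t) ?x \<in> {xs m, xs k}" "diag (\<not> ?s) ?t ?x \<in> {xs m, xs k}"
    using pm sm xk dirs by (cases "vertical J0 ?x"; simp)+
  have "u = ?s \<or> u = (\<not> ?s)" "v = ?t \<or> v = (\<not> ?t)" by auto
  then have "diag u v ?x \<in> {xs m, xs (Suc n), xs k, xs (Suc (Suc k))}"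
    using 1 2 3 by auto
  then have "diag u v ?x \<in> xs ` {m, Suc n, k, Suc (Suc k)}"
    by (simp only: image_insert image_empty)
  then obtain l where "diag u v ?x = xs l" "l \<in> {m, Suc n, k, Suc (Suc k)}" by (rule imageE)
  then show ?thesis using nk m by (intro exI[of _ l]) auto
qed

section \<open>Vertices visited infinitely often\<close>

definition recurrent :: "vert set" where
  "recurrent = {x. \<forall>N. \<exists>n>N. xs n = x}"

lemma recurrent_step:
  assumes "x \<in> recurrent"
  shows "diag u v x \<in> recurrent"
proof -
  have "\<exists>m>N. xs m = diag u v x" for N
  proof -
    have inf: "\<exists>n>M. xs n = x" for M
      using assms by (auto simp: recurrent_def)
    \<comment> \<open>The margin of two ensures that a neighbour visited as early as
      \<open>n - 1\<close> still comes after \<open>N\<close>.\<close>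
    obtain n where n: "n > Suc (Suc N)" "xs n = x" using inf by blast
    \<comment> \<open>The next visit after \<open>n\<close>, so that none lies in between, as
      \<open>revisit\<close> demands.\<close>
    define l where "l = (LEAST l. n < l \<and> xs l = x)"
    have l: "n < l" "xs l = x"
      using LeastI_ex[OF inf[of n]] by (auto simp: l_def)
    have least: "xs i \<noteq> x" if "n < i" "i < l" for i
      using not_less_Least[of i "\<lambda>l. n < l \<and> xs l = x"] that by (auto simp: l_def)
    obtain k where k: "l = Suc k" using l by (cases l) auto
    obtain m where "n - 1 \<le> m" "xs m = diag u v (xs n)"
      using revisit[of n k u v] n l k least by auto
    then show ?thesis using n by (intro exI[of _ m]) auto
  qed
  then show ?thesis unfolding recurrent_def by blast
qed

lemma recurrent_nonempty: "recurrent \<noteq> {}"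
proof -
  have "finite (range xs)" using xs_V by (intro finite_subset[OF _ finite_V]) auto
  then obtain n where "infinite {m \<in> UNIV. xs m = xs n}"
    using pigeonhole_infinite[of "UNIV :: nat set" xs] by auto
  then have "\<exists>m>N. xs m = xs n" for N
    unfolding finite_nat_set_iff_bounded_le by (auto simp: not_le)
  then have "xs n \<in> recurrent" unfolding recurrent_def by blast
  then show ?thesis by blast
qed


text \<open>Diagonal steps in one direction reach the right column; a step up-right followed by one
  up-left then rises by 2 within the column. Equal colours make the remaining height even.\<close>

lemma colour_class_subset: "{x \<in> V L. colour x = colour x0} \<subseteq> D"
proof
  fix z assume "z \<in> {x \<in> V L. colour x = colour x0}"
  then have z: "z \<in> V L" "colour z = colour x0" by auto
  have recD: "x \<in> D" "x \<in> V L" "colour x = colour x0" if x: "x \<in> recurrent" for x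
  proof -
    obtain n where "x = xs n" using x unfolding recurrent_def by blast
    then show "x \<in> D" "x \<in> V L" "colour x = colour x0" using xs_D xs_V xs_colour by auto
  qed
  have diag: "((i + n) mod L, (j + n) mod L) \<in> recurrent" if "(i, j) \<in> recurrent" for i j n
  proof (induction n)
    case 0
    then show ?case using that recD(2)[OF that] by (simp add: V_iff)
  next
    case (Suc n)
    then show ?case using recurrent_step[OF Suc, of True True]
      by (simp add: hor_def ver_def shift_def mod_Suc_eq)
  qed
  have up: "(i, (j + 2 * n) mod L) \<in> recurrent" if "(i, j) \<in> recurrent" for i j n
  proof (induction n)
    case 0
    then show ?case using that recD(2)[OF that] by (simp add: V_iff)
  next
    case (Suc n)
    have i: "i < L" using recD(2)[OF that] by (simp add: V_iff)
    have "diag False True (diag True True (i, (j + 2 * n) mod L)) \<in> recurrent"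
      using Suc by (intro recurrent_step)
    then show ?case using shift_shift[OF i, of True False]
      by (simp add: hor_def ver_def) (simp add: shift_def mod_Suc_eq)
  qed
  obtain i j where ij: "(i, j) \<in> recurrent" using recurrent_nonempty by auto
  obtain a b where ab: "z = (a, b)" by (cases z)
  have lt: "i < L" "j < L" "a < L" "b < L" using recD(2)[OF ij] z ab by (auto simp: V_iff)
  \<comment> \<open>The summand \<open>L\<close> prevents truncated subtraction and vanishes modulo
    \<open>L\<close>; likewise in \<open>b + L - j'\<close> below.\<close>
  define n where "n = a + L - i"
  define j' where "j' = (j + n) mod L"
  have "(i + n) mod L = a" using lt by (simp add: n_def)
  with diag[OF ij, of n] have "(a, j') \<in> recurrent" by (simp add: j'_def)
  from up[OF this, of "(b + L - j') div 2"]
  have "(a, (j' + 2 * ((b + L - j') div 2)) mod L) \<in> recurrent" .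
  moreover have "even (b + L - j')"
  proof -
    have "even j' \<longleftrightarrow> even (j + n)" using evL by (simp add: j'_def dvd_mod_iff)
    moreover have "even (i + j) \<longleftrightarrow> even (a + b)"
      using recD(3)[OF ij] z(2) ab by (simp add: colour_def)
    moreover have "j' < L" using lt by (simp add: j'_def)
    ultimately show ?thesis using lt evL by (auto simp: n_def)
  qed
  moreover have "j' \<le> b + L" using lt L4 by (simp add: j'_def less_imp_le trans_le_add2)
  ultimately have "z \<in> recurrent" using lt ab by simp
  then show "z \<in> D" by (rule recD)
qed

end

section \<open>Normal form of minimum joins\<close>

context torus
begin

lemma min_join_normal_form:
  assumes D: "D \<subseteq> V L" "even (card D)" and min: "is_min_join L D J"
  shows "\<exists>P\<subseteq>V L. is_min_join L D (symdiff J (psum L P)) \<and>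
    (\<forall>v\<in>D. jdeg (symdiff J (psum L P)) v = 1)"
proof -
  \<comment> \<open>Recording the set \<open>P\<close> ties the walk to the required form of
    \<open>J'\<close>; a flip toggles one plaquette in \<open>P\<close>.\<close>
  define G where "G J' \<longleftrightarrow> is_min_join L D J' \<and> (\<exists>P\<subseteq>V L. J' = symdiff J (psum L P))" for J'
  have "J = symdiff J (psum L {})" by (auto simp: psum_def symdiff_def)
  then have GJ: "G J" using min unfolding G_def by blast
  obtain J0 where J0: "G J0" "\<And>J'. G J' \<Longrightarrow> defects D J0 \<le> defects D J'"
    using ex_has_least_nat[of G J "defects D"] GJ by blast
  have join0: "J0 \<subseteq> E L" "\<And>v. v \<in> V L \<Longrightarrow> odd (jdeg J0 v) \<longleftrightarrow> v \<in> D"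
    using J0(1) by (auto simp: G_def is_min_join_def is_join_def)
  have flip: "G (symdiff K (pbound L f))"
    if "G K" "f \<in> V L" "card (symdiff K (pbound L f)) = card K" for K f
  proof -
    obtain P where P: "P \<subseteq> V L" "K = symdiff J (psum L P)" using \<open>G K\<close> by (auto simp: G_def)
    have "finite P" using P(1) by (rule finite_subset) simp
    then have "symdiff K (pbound L f) = symdiff J (psum L (symdiff P {f}))"
      by (auto simp: psum_toggle P(2))
    moreover have "symdiff P {f} \<subseteq> V L" using P(1) that(2) by (auto simp: symdiff_def)
    moreover have minK: "is_min_join L D K" using \<open>G K\<close> by (simp add: G_def)
    moreover have "is_join L D (symdiff K (pbound L f))"
      using minK that(2) unfolding pbound_eq_plaq by (intro join_flip) (simp_all add: is_min_join_def)
    ultimately show ?thesis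
      unfolding G_def using min_join_flip[OF minK _ that(3)] by blast
  qed
  \<comment> \<open>A remaining defect has degree 3 and so starts the endless walk. This forces its
    whole colour class into \<open>D\<close>, where every degree must then be 1.\<close>
  have "jdeg J0 v = 1" if v: "v \<in> D" for v
  proof (rule ccontr)
    assume not1: "jdeg J0 v \<noteq> 1"
    have vV: "v \<in> V L" using v D by auto
    have "jdeg J0 v \<le> 4"
      using jdeg_eq[OF join0(1) vV, of True True] by (simp add: of_bool_def)
    moreover have "odd (jdeg J0 v)" using join0(2)[OF vV] v by simp
    ultimately have "jdeg J0 v = 3" using not1 by presburger
    then obtain s t where "tee J0 v s t" using tee_exists[OF join0(1) vV] by blast
    then interpret stuck L D G J0 v s t
      using D J0 flip v by unfold_locales (auto simp: G_def)
    have "is_min_join L D J0" using J0(1) by (simp add: G_def)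
    then have "jdeg J0 v = 1"
      using jdeg_eq_1_if_colour_class_subset[OF _ D colour_class_subset vV refl] by blast
    with not1 show False by simp
  qed
  then show ?thesis using J0(1) unfolding G_def by blast
qed

lemma exists_min_join:
  assumes "D \<subseteq> V L" "even (card D)"
  shows "\<exists>J. is_min_join L D J"
proof -
  obtain J where "is_join L D J" using exists_join[OF assms] by blast
  then show ?thesis
    using ex_has_least_nat[of "is_join L D" J card] by (auto simp: is_min_join_def)
qed

end

theorem theorem3p1:
  fixes L :: nat and D :: "vert set"
  assumes "L \<ge> 4" and "even L" and "D \<subseteq> V L" and "even (card D)"
  shows "(\<exists>J. is_min_join L D J \<and> (\<forall>v \<in> D. jdeg J v = 1))
       \<and> (\<forall>J. is_min_join L D J \<longrightarrow>
            (\<exists>P \<subseteq> V L. card (symdiff J (psum L P)) = card J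
                        \<and> (\<forall>v \<in> D. jdeg (symdiff J (psum L P)) v = 1)))"
proof -
  interpret torus L using assms by unfold_locales auto
  note normal_form = min_join_normal_form[OF assms(3,4)]
  obtain J where "is_min_join L D J" using exists_min_join[OF assms(3,4)] by blast
  then have "\<exists>J. is_min_join L D J \<and> (\<forall>v\<in>D. jdeg J v = 1)"
    using normal_form by blast
  moreover have "card K = card J" if "is_min_join L D J" "is_min_join L D K" for J K
    using that by (auto simp: is_min_join_def intro: antisym)
  ultimately show ?thesis using normal_form by meson
qed

end
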